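(* For every integer $r\ge 4$ there exists an integer $q_0=q_0(r)$ such that the following holds for all integers $q\ge q_0$ and $s$ with $1\le s\le r-1$, where $n=qr+s$. (i) If $q$ and $r-s$ are both odd, then $\mathrm{regex}(n,K_{r+1})=\delta(n,r)-1$. (ii) If $q$ and $r$ are both even and $s=r-1$, then $\mathrm{regex}(n,K_{r+1})=\delta(n,r)-2$. (iii) If $q$ is even, $r$ is odd and $s=r-1$, then $\mathrm{regex}(n,K_{r+1})=\delta(n,r)-1$.
   Context: All graphs are finite and simple. A graph is $F$-free if it contains no copy of $F$ as a (not necessarily induced) subgraph. For a graph $F$, $\mathrm{regex}(n,F)$ denotes the maximum integer $d\ge 0$ such that there exists a $d$-regular $F$-free graph on $n$ vertices. $K_{r+1}$ is the complete graph on $r+1$ vertices. $\delta(n,r)$ denotes the minimum degree of the $r$-partite Turán graph on $n$ vertices (the complete $r$-partite graph whose part sizes differ by at most one); that is, if $n=qr+s$ with $0\le s<r$, then $\delta(n,r)=n-q$ if $s=0$ and $\delta(n,r)=n-q-1$ otherwise. *)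

theory Defs
  imports Complex_Main
begin

text \<open>A graph is a pair of a vertex set and a set of edges; an edge of a finite simple graph is a
  two-element set of vertices.\<close>

type_synonym 'a ugraph = "'a set \<times> 'a set set"

definition verts :: "'a ugraph \<Rightarrow> 'a set" where
  "verts G = fst G"

definition edges :: "'a ugraph \<Rightarrow> 'a set set" where
  "edges G = snd G"

definition simple_graph :: "'a ugraph \<Rightarrow> bool" where
  "simple_graph G \<longleftrightarrow> finite (verts G) \<and> (\<forall>e\<in>edges G. e \<subseteq> verts G \<and> card e = 2)"

definition degree :: "'a ugraph \<Rightarrow> 'a \<Rightarrow> nat" where
  "degree G v = card {u \<in> verts G. {v, u} \<in> edges G}"

definition regular :: "'a ugraph \<Rightarrow> nat \<Rightarrow> bool" where
  "regular G d \<longleftrightarrow> (\<forall>v\<in>verts G. degree G v = d)"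

definition min_degree :: "'a ugraph \<Rightarrow> nat" where
  "min_degree G = Min (degree G ` verts G)"

text \<open>Copies are not required to be induced: only edges of \<open>F\<close> have to be preserved.\<close>

definition contains_copy :: "'a ugraph \<Rightarrow> 'b ugraph \<Rightarrow> bool" where
  "contains_copy G F \<longleftrightarrow>
     (\<exists>f. inj_on f (verts F) \<and> f ` verts F \<subseteq> verts G \<and> (\<forall>e\<in>edges F. f ` e \<in> edges G))"

definition free_of :: "'a ugraph \<Rightarrow> 'b ugraph \<Rightarrow> bool" where
  "free_of G F \<longleftrightarrow> \<not> contains_copy G F"

definition complete_graph :: "nat \<Rightarrow> nat ugraph" where
  "complete_graph k = ({..<k}, {e. e \<subseteq> {..<k} \<and> card e = 2})"

text \<open>Since every finite graph is isomorphic to one whose vertices are natural numbers, it is no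
  restriction to let \<open>G\<close> range over those. \<open>Max\<close> is meaningful whenever the set is finite and
  nonempty; for \<open>n > 0\<close> and a complete graph \<open>F\<close> on at least two vertices this is
  \<open>regex_set_finite\<close> and \<open>regex_set_nonempty\<close> below.\<close>

definition regex_set :: "nat \<Rightarrow> 'b ugraph \<Rightarrow> nat set" where
  "regex_set n F =
     {d. \<exists>G :: nat ugraph. simple_graph G \<and> card (verts G) = n \<and> regular G d \<and> free_of G F}"

definition regex :: "nat \<Rightarrow> 'b ugraph \<Rightarrow> nat" where
  "regex n F = Max (regex_set n F)"

text \<open>The parts of the Turan graph are the residue classes modulo \<open>r\<close> in \<open>{..<n}\<close>; their sizes
  are computed in \<open>card_residue_class\<close> below and differ by at most one.\<close>

definition turan_graph :: "nat \<Rightarrow> nat \<Rightarrow> nat ugraph" where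
  "turan_graph n r = ({..<n}, {{u, v} | u v. u < n \<and> v < n \<and> u mod r \<noteq> v mod r})"

definition turan_delta :: "nat \<Rightarrow> nat \<Rightarrow> nat" where
  "turan_delta n r = min_degree (turan_graph n r)"


lemma regex_set_finite:
  assumes "n > 0"
  shows "finite (regex_set n F)"
proof (rule finite_subset)
  show "regex_set n F \<subseteq> {..n}"
  proof
    fix d assume "d \<in> regex_set n F"
    then obtain G :: "nat ugraph" where G: "simple_graph G" "card (verts G) = n" "regular G d"
      by (auto simp: regex_set_def)
    then obtain v where "v \<in> verts G" using assms by fastforce
    then have "d = card {u \<in> verts G. {v, u} \<in> edges G}"
      using G(3) by (simp add: regular_def degree_def)
    also have "\<dots> \<le> card (verts G)"
      using G(1) by (intro card_mono) (auto simp: simple_graph_def)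
    finally show "d \<in> {..n}" using G(2) by simp
  qed
qed simp

lemma regex_set_nonempty:
  assumes "k \<ge> 2"
  shows "0 \<in> regex_set n (complete_graph k)"
proof -
  let ?G = "({..<n}, {}) :: nat ugraph"
  have "{0, 1} \<in> edges (complete_graph k)"
    using assms by (auto simp: complete_graph_def edges_def)
  then have "free_of ?G (complete_graph k)"
    by (auto simp: free_of_def contains_copy_def edges_def)
  then have "simple_graph ?G \<and> card (verts ?G) = n \<and> regular ?G 0 \<and> free_of ?G (complete_graph k)"
    by (auto simp: simple_graph_def regular_def degree_def verts_def edges_def)
  then show ?thesis unfolding regex_set_def by blast
qed

lemma simple_turan_graph: "simple_graph (turan_graph n r)"
  by (auto simp: simple_graph_def turan_graph_def verts_def edges_def card_2_iff)

lemma card_residue_class: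
  assumes "i < r" "s < r"
  shows "card {u. u < q * r + s \<and> u mod r = i} = (if i < s then q + 1 else q)"
proof -
  define m where "m = (if i < s then q + 1 else q)"
  have bound: "k * r + i < q * r + s \<longleftrightarrow> k < m" for k
  proof (cases k q rule: linorder_cases)
    case less
    then have "Suc k * r \<le> q * r" by (intro mult_le_mono1) simp
    then show ?thesis using less assms by (simp add: m_def)
  next
    case greater
    then have "Suc q * r \<le> k * r" by (intro mult_le_mono1) simp
    then show ?thesis using greater assms by (simp add: m_def)
  qed (simp add: m_def)
  have "{u. u < q * r + s \<and> u mod r = i} = (\<lambda>k. k * r + i) ` {..<m}"
  proof (intro equalityI subsetI)
    fix u assume "u \<in> {u. u < q * r + s \<and> u mod r = i}"
    then have u: "u < q * r + s" "u mod r = i" by auto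
    define k where "k = u div r"
    have uk: "u = k * r + i" using u(2) by (metis k_def div_mult_mod_eq)
    then have "k < m" using bound[of k] u(1) by blast
    then show "u \<in> (\<lambda>k. k * r + i) ` {..<m}" using uk by blast
  next
    fix u assume "u \<in> (\<lambda>k. k * r + i) ` {..<m}"
    then obtain k where "k < m" "u = k * r + i" by blast
    then show "u \<in> {u. u < q * r + s \<and> u mod r = i}"
      using bound[of k] assms(1) by simp
  qed
  moreover have "inj_on (\<lambda>k. k * r + i) {..<m}" using assms by (auto simp: inj_on_def)
  ultimately show ?thesis by (simp add: card_image m_def)
qed

lemma degree_turan_graph:
  assumes "s < r" "n = q * r + s" "v < n"
  shows "degree (turan_graph n r) v = (if v mod r < s then n - q - 1 else n - q)"
proof -
  have "{u \<in> verts (turan_graph n r). {v, u} \<in> edges (turan_graph n r)}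
      = {..<n} - {u. u < n \<and> u mod r = v mod r}"
    using assms by (auto simp: turan_graph_def verts_def edges_def doubleton_eq_iff)
  moreover have "card ({..<n} - {u. u < n \<and> u mod r = v mod r})
      = n - card {u. u < n \<and> u mod r = v mod r}"
    by (subst card_Diff_subset) auto
  moreover have "v mod r < r" using assms by simp
  ultimately show ?thesis
    using card_residue_class[of "v mod r" r s q] assms by (simp add: degree_def)
qed

text \<open>The closed formula for the minimum degree of the Turan graph.\<close>

lemma turan_delta_eq:
  assumes "s < r" "n = q * r + s" "n > 0"
  shows "turan_delta n r = (if s = 0 then n - q else n - q - 1)"
proof -
  have V: "verts (turan_graph n r) = {..<n}" by (simp add: turan_graph_def verts_def)
  have zero: "degree (turan_graph n r) 0 = (if s = 0 then n - q else n - q - 1)"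
    using degree_turan_graph[OF assms(1,2), of 0] assms by simp
  show ?thesis unfolding turan_delta_def min_degree_def V
  proof (rule Min_eqI)
    show "(if s = 0 then n - q else n - q - 1) \<in> degree (turan_graph n r) ` {..<n}"
      using zero assms(3) by (metis imageI lessThan_iff)
  next
    fix y assume "y \<in> degree (turan_graph n r) ` {..<n}"
    then show "(if s = 0 then n - q else n - q - 1) \<le> y"
      using degree_turan_graph[OF assms(1,2)] by auto
  qed simp
qed

end

theory Submission imports Defs begin

text \<open>Pass to the complement \<open>H\<close> of a \<open>d\<close>-regular \<open>K\<^bsub>r+1\<^esub>\<close>-free graph: it is
  \<open>(n - 1 - d)\<close>-regular without independent sets of size \<open>r + 1\<close>. The closed neighbourhoods of a
  maximal independent set cover \<open>H\<close>, so \<open>d \<le> \<delta>(n,r)\<close>. For \<open>n = (q + 1) r - 1\<close> and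
  \<open>d = \<delta>(n,r)\<close> exactly one vertex \<open>w\<close> is covered twice. Without \<open>w\<close>, the two
  neighbourhoods containing it are cliques of size \<open>q\<close>, and non-neighbours of \<open>w\<close> in different ones
  are adjacent; as a vertex has only one neighbour outside its clique, \<open>w\<close> would have at least
  \<open>2 * (q - 1) > q\<close> neighbours. The handshake lemma excludes the
  remaining degrees. For the lower bounds, \<open>H\<close> is a disjoint union of small blocks; each
  block consists of cliques together with a few cross edges that make it regular, so that \<open>r\<close> cliques
  cover \<open>H\<close>.\<close>

section \<open>Regular graphs covered by cliques\<close>

text \<open>\<open>E\<close> is adjacency in the complement \<open>H\<close>. The classes of
  \<open>c\<close>, possibly empty, are the covering cliques, so an independent set has at most
  \<open>k\<close> vertices.\<close>

definition clique_covered :: "nat \<Rightarrow> nat \<Rightarrow> 'a set \<Rightarrow> ('a \<Rightarrow> 'a \<Rightarrow> bool) \<Rightarrow> ('a \<Rightarrow> nat) \<Rightarrow> bool" where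
  "clique_covered D k V E c \<longleftrightarrow> finite V
     \<and> (\<forall>x\<in>V. \<not> E x x) \<and> (\<forall>x\<in>V. \<forall>y\<in>V. E x y \<longleftrightarrow> E y x)
     \<and> (\<forall>x\<in>V. card {y\<in>V. E x y} = D)
     \<and> (\<forall>x\<in>V. c x < k) \<and> (\<forall>x\<in>V. \<forall>y\<in>V. x \<noteq> y \<longrightarrow> c x = c y \<longrightarrow> E x y)"

definition coverable :: "nat \<Rightarrow> nat \<Rightarrow> nat \<Rightarrow> bool" where
  "coverable D k n \<longleftrightarrow> (\<exists>(V :: nat set) E c. clique_covered D k V E c \<and> card V = n)"

text \<open>Transport along a bijection with \<open>{0..<card V}\<close>: blocks may live on pairs
  or sums although \<open>coverable\<close> fixes the vertex type \<open>nat\<close>.\<close>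

lemma coverableI:
  fixes V :: "'a set"
  assumes "clique_covered D k V E c" "card V = n"
  shows "coverable D k n"
proof -
  have fin: "finite V" using assms by (simp add: clique_covered_def)
  then obtain g where g: "bij_betw g V {0..<card V}" using ex_bij_betw_finite_nat by blast
  define h where "h = inv_into V g"
  let ?W = "{0..<card V}"
  have h: "bij_betw h ?W V" unfolding h_def using g by (rule bij_betw_inv_into)
  have hV: "h x \<in> V" if "x \<in> ?W" for x using h that by (meson bij_betwE)
  have hinj: "h x = h y \<longleftrightarrow> x = y" if "x \<in> ?W" "y \<in> ?W" for x y
    using h that by (meson bij_betw_imp_inj_on inj_on_eq_iff)
  have "card {y \<in> ?W. E (h x) (h y)} = D" if x: "x \<in> ?W" for x
  proof -
    have "h ` {y \<in> ?W. E (h x) (h y)} = {y \<in> h ` ?W. E (h x) y}" by blast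
    then have "h ` {y \<in> ?W. E (h x) (h y)} = {y\<in>V. E (h x) y}"
      using h by (simp add: bij_betw_def)
    moreover have "card (h ` {y \<in> ?W. E (h x) (h y)}) = card {y \<in> ?W. E (h x) (h y)}"
      by (intro card_image inj_on_subset[OF bij_betw_imp_inj_on[OF h]]) auto
    ultimately show ?thesis using assms(1) hV[OF x] by (simp add: clique_covered_def)
  qed
  then have "clique_covered D k ?W (\<lambda>x y. E (h x) (h y)) (\<lambda>x. c (h x))"
    using assms(1) hV hinj unfolding clique_covered_def by (simp del: atLeastLessThan_iff)
  moreover have "card ?W = n" using assms(2) by simp
  ultimately show ?thesis unfolding coverable_def by blast
qed

lemma coverable_0: "coverable D 0 0"
  by (rule coverableI[where V = "{} :: nat set" and E = "\<lambda>_ _. False" and c = "\<lambda>_. 0"])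
    (auto simp: clique_covered_def)

lemma coverable_add:
  assumes "coverable D k n" "coverable D l m"
  shows "coverable D (k + l) (n + m)"
proof -
  obtain V E c where 1: "clique_covered D k (V :: nat set) E c" "card V = n"
    using assms(1) by (auto simp: coverable_def)
  obtain W F d where 2: "clique_covered D l (W :: nat set) F d" "card W = m"
    using assms(2) by (auto simp: coverable_def)
  define R where "R p q = (case (p, q) of (Inl x, Inl y) \<Rightarrow> E x y | (Inr x, Inr y) \<Rightarrow> F x y | _ \<Rightarrow> False)"
    for p q :: "nat + nat"
  have R: "R (Inl x) (Inl y) = E x y" "R (Inr x) (Inr y) = F x y"
    "\<not> R (Inl x) (Inr y)" "\<not> R (Inr x) (Inl y)" for x y by (auto simp: R_def)
  have L: "{y \<in> V <+> W. R (Inl x) y} = Inl ` {y\<in>V. E x y}" for x using R by auto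
  have M: "{y \<in> V <+> W. R (Inr x) y} = Inr ` {y\<in>W. F x y}" for x using R by auto
  have "clique_covered D (k + l) (V <+> W) R (case_sum c (\<lambda>x. k + d x))"
    using 1(1) 2(1) unfolding clique_covered_def
    by (auto simp: R L M card_image) blast+
  moreover have "card (V <+> W) = n + m"
    using 1 2 by (simp add: card_Plus clique_covered_def)
  ultimately show ?thesis by (rule coverableI)
qed

lemma coverable_mult: "coverable D k n \<Longrightarrow> coverable D (j * k) (j * n)"
proof (induction j)
  case (Suc j)
  then show ?case using coverable_add[of D k n "j * k" "j * n"] by simp
qed (simp add: coverable_0)

text \<open>Row \<open>i\<close> is a clique on \<open>sz i\<close> vertices, and \<open>S\<close> lists the cross edges, directed towards the
  row of larger index.\<close>

lemma coverable_rows: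
  fixes sz :: "nat \<Rightarrow> nat" and S :: "nat \<Rightarrow> nat \<Rightarrow> nat \<Rightarrow> nat \<Rightarrow> bool"
  assumes S: "\<And>i x j y. S i x j y \<Longrightarrow> i < j"
    and deg: "\<And>i x. i < k \<Longrightarrow> x < sz i \<Longrightarrow>
      \<exists>T. card T = D + 1 - sz i \<and> (\<forall>j y. (j, y) \<in> T \<longleftrightarrow> j < k \<and> y < sz j \<and> (S i x j y \<or> S j y i x))"
    and sz: "\<And>i. i < k \<Longrightarrow> sz i \<le> D + 1" and n: "n = (\<Sum>i<k. sz i)"
  shows "coverable D k n"
proof -
  define V where "V = Sigma {..<k} (\<lambda>i. {..<sz i})"
  define E where "E p q \<longleftrightarrow> fst p = fst q \<and> snd p \<noteq> snd q \<or> S (fst p) (snd p) (fst q) (snd q)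
     \<or> S (fst q) (snd q) (fst p) (snd p)" for p q :: "nat \<times> nat"
  have irr: "\<not> S i x i y" for i x y using S by blast
  have "card {q\<in>V. E (i, x) q} = D" if ix: "i < k" "x < sz i" for i x
  proof -
    obtain T where T: "card T = D + 1 - sz i"
      "\<And>j y. (j, y) \<in> T \<longleftrightarrow> j < k \<and> y < sz j \<and> (S i x j y \<or> S j y i x)"
      using deg[OF ix] by blast
    \<comment> \<open>The own row contributes \<open>sz i - 1\<close> neighbours, so
      \<open>D + 1 - sz i\<close> cross neighbours are missing.\<close>
    have eq: "{q\<in>V. E (i, x) q} = Pair i ` ({..<sz i} - {x}) \<union> T"
      using ix T(2) irr by (auto simp: V_def E_def)
    have "finite T"
      by (rule finite_subset[of _ V]) (auto simp: V_def T(2))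
    moreover have "Pair i ` ({..<sz i} - {x}) \<inter> T = {}" using irr by (auto simp: T(2))
    moreover have "card (Pair i ` ({..<sz i} - {x})) = sz i - 1"
      using ix by (subst card_image) (auto simp: inj_on_def)
    ultimately show ?thesis unfolding eq
      using T(1) ix sz[OF ix(1)] by (subst card_Un_disjoint) auto
  qed
  then have "\<forall>p\<in>V. card {q\<in>V. E p q} = D" by (auto simp: V_def)
  then have "clique_covered D k V E fst"
    unfolding clique_covered_def
  proof (intro conjI)
    show "finite V" by (simp add: V_def)
    show "\<forall>p\<in>V. \<not> E p p" by (simp add: E_def irr)
    show "\<forall>p\<in>V. \<forall>q\<in>V. E p q \<longleftrightarrow> E q p" by (auto simp: E_def)
    show "\<forall>p\<in>V. fst p < k" by (auto simp: V_def)
    show "\<forall>p\<in>V. \<forall>q\<in>V. p \<noteq> q \<longrightarrow> fst p = fst q \<longrightarrow> E p q" by (auto simp: E_def)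
  qed
  moreover have "card V = n" by (simp add: V_def n)
  ultimately show ?thesis by (rule coverableI)
qed

section \<open>Blocks of degree \<open>q + 1\<close>\<close>

lemma coverable_clique: "coverable (q + 1) 1 (q + 2)"
  by (rule coverable_rows[where sz = "\<lambda>_. q + 2" and S = "\<lambda>_ _ _ _. False"])
    (auto intro!: exI[of _ "{}"])

text \<open>A vertex of a clique of size \<open>q\<close> lacks two neighbours; the cross edges
  supply them along one cycle through all \<open>2 * q\<close> vertices.\<close>

lemma coverable_two:
  assumes "q \<ge> 2"
  shows "coverable (q + 1) 2 (2 * q)"
proof (rule coverable_rows[where sz = "\<lambda>_. q" and
      S = "\<lambda>i x j y. i = 0 \<and> j = 1 \<and> (y = x \<or> y = (if x = q - 1 then 0 else x + 1))"], goal_cases)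
  case (2 i x)
  then consider "i = 0" | "i = 1" by linarith
  then show ?case
  proof cases
    case 1
    show ?thesis
      by (rule exI[of _ "{(1, x), (1, if x = q - 1 then 0 else x + 1)}"])
        (use 1 2 assms in auto)
  next
    case 2
    show ?thesis
      by (rule exI[of _ "{(0, x), (0, if x = 0 then q - 1 else x - 1)}"])
        (use 2 \<open>x < q\<close> assms in auto)
  qed
qed auto

text \<open>The two missing neighbours come from a cross triangle in each column.\<close>

lemma coverable_three: "coverable (q + 1) 3 (3 * q)"
proof (rule coverable_rows[where sz = "\<lambda>_. q" and S = "\<lambda>i x j y. i < j \<and> x = y"], goal_cases)
  case (2 i x)
  have "card ((\<lambda>j. (j, x)) ` ({..<3} - {i})) = 2"
    using 2 by (subst card_image) (auto simp: inj_on_def)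
  then show ?case
    using 2 by (intro exI[of _ "(\<lambda>j. (j, x)) ` ({..<3} - {i})"]) auto
qed auto

text \<open>In the next two blocks \<open>h\<close> of the cross edges of \<open>coverable_two\<close> and \<open>coverable_three\<close> are
  removed, and their \<open>2 * h\<close> endpoints are matched with an additional clique.\<close>

lemma coverable_two_plus:
  assumes "q + 1 = 2 * h" "h \<ge> 2"
  shows "coverable (q + 1) 3 (2 * q + (q + 1))"
\<comment> \<open>Each of the \<open>q + 1 = 2 * h\<close> vertices of the additional clique lacks
  one neighbour, which fixes the number \<open>h\<close> of removed edges. These are the edges
  between \<open>(0, x)\<close> and \<open>(1, x)\<close> with \<open>x < h\<close>.\<close>
proof (rule coverable_rows[where sz = "\<lambda>i. if i = 2 then q + 1 else q" and
      S = "\<lambda>i x j y. i = 0 \<and> j = 1 \<and> (y = x \<and> h \<le> x \<or> y = (if x = q - 1 then 0 else x + 1))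
        \<or> i = 0 \<and> j = 2 \<and> y = x \<and> x < h \<or> i = 1 \<and> j = 2 \<and> y = h + x \<and> x < h"], goal_cases)
  case (2 i x)
  then consider "i = 0" | "i = 1" | "i = 2" by linarith
  then show ?case
  proof cases
    case 1
    show ?thesis
      by (rule exI[of _ "{if x < h then (2, x) else (1, x), (1, if x = q - 1 then 0 else x + 1)}"])
        (use 1 2 assms in auto)
  next
    case 2
    show ?thesis
      by (rule exI[of _ "{if x < h then (2, h + x) else (0, x), (0, if x = 0 then q - 1 else x - 1)}"])
        (use 2 \<open>x < (if i = 2 then q + 1 else q)\<close> assms in auto)
  next
    case 3
    show ?thesis
      by (rule exI[of _ "{if x < h then (0, x) else (1, x - h)}"])
        (use 3 2 assms in auto)
  qed
qed (auto simp: numeral_3_eq_3 numeral_2_eq_2)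

lemma coverable_three_plus:
  assumes "q + 1 = 2 * h"
  shows "coverable (q + 1) 4 (3 * q + (q + 1))"
proof (rule coverable_rows[where sz = "\<lambda>i. if i = 3 then q + 1 else q" and
      S = "\<lambda>i x j y. i < j \<and> j < 3 \<and> x = y \<and> \<not> (x < h \<and> i = 0 \<and> j = 1)
        \<or> i = 0 \<and> j = 3 \<and> y = x \<and> x < h \<or> i = 1 \<and> j = 3 \<and> y = h + x \<and> x < h"], goal_cases)
  case (2 i x)
  then consider "i = 0" | "i = 1" | "i = 2" | "i = 3" by linarith
  then show ?case
  proof cases
    case 1
    show ?thesis
      by (rule exI[of _ "{if x < h then (3, x) else (1, x), (2, x)}"])
        (use 1 2 assms in auto)
  next
    case 2
    show ?thesis
      by (rule exI[of _ "{if x < h then (3, h + x) else (0, x), (2, x)}"])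
        (use 2 \<open>x < (if i = 3 then q + 1 else q)\<close> assms in auto)
  next
    case 3
    show ?thesis
      by (rule exI[of _ "{(0, x), (1, x)}"])
        (use 3 2 assms in auto)
  next
    case 4
    show ?thesis
      by (rule exI[of _ "{if x < h then (0, x) else (1, x - h)}"])
        (use 4 2 assms in auto)
  qed
qed (auto simp: eval_nat_numeral)

text \<open>Here \<open>h\<close> of the triangles formed by the cross edges of \<open>coverable_three\<close> are replaced by copies
  of \<open>K\<^bsub>3,2\<^esub>\<close>, whose smaller sides make up the additional clique.\<close>

lemma coverable_three_minus:
  assumes "q = 2 * h + 1"
  shows "coverable (q + 1) 4 (4 * q - 1)"
\<comment> \<open>Row 3 has \<open>q - 1 = 2 * h\<close> vertices, each lacking three neighbours;
  every K_{3,2} takes two of these vertices.\<close>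
proof (rule coverable_rows[where sz = "\<lambda>i. if i = 3 then q - 1 else q" and
      S = "\<lambda>i x j y. i < j \<and> j < 3 \<and> x = y \<and> h \<le> x
        \<or> i < 3 \<and> j = 3 \<and> x < h \<and> (y = x \<or> y = h + x)"], goal_cases)
  case (2 i x)
  then consider "i < 3" "x < h" | "i < 3" "h \<le> x" | "i = 3" by linarith
  then show ?case
  proof cases
    case 1
    show ?thesis
      by (rule exI[of _ "{(3, x), (3, h + x)}"])
        (use 1 2 assms in auto)
  next
    case 2
    have "card ((\<lambda>j. (j, x)) ` ({..<3} - {i})) = 2"
      using 2 by (subst card_image) (auto simp: inj_on_def)
    then show ?thesis
      using 2 \<open>x < (if i = 3 then q - 1 else q)\<close> assms
      by (intro exI[of _ "(\<lambda>j. (j, x)) ` ({..<3} - {i})"]) auto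
  next
    case 3
    \<comment> \<open>The column whose K_{3,2} contains vertex \<open>x\<close> of row 3.\<close>
    define z where "z = (if x < h then x else x - h)"
    show ?thesis
      by (rule exI[of _ "{(0, z), (1, z), (2, z)}"])
        (use 3 2 assms in \<open>auto simp: z_def\<close>)
  qed
qed (use assms in \<open>auto simp: eval_nat_numeral\<close>)

section \<open>Assembling the blocks\<close>

text \<open>Blocks of two rows suffice, apart from one of three rows when \<open>m\<close> is odd.
  One block is kept apart so that a variant with an additional clique can take its place.\<close>

lemma ge_2_cases:
  fixes m :: nat
  assumes "m \<ge> 2"
  obtains j where "m = 2 + j * 2" | j where "m = 3 + j * 2"
proof (cases "even m")
  case True
  then have "m = 2 + ((m - 2) div 2) * 2" using assms by auto
  then show ?thesis by (rule that(1))
next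
  case False
  then have "m = 3 + ((m - 3) div 2) * 2" using assms by presburger
  then show ?thesis by (rule that(2))
qed

lemma coverable_copies:
  assumes "q \<ge> 2" "m \<ge> 2"
  shows "coverable (q + 1) m (m * q)"
  using assms(2)
proof (cases rule: ge_2_cases)
  case (1 j)
  then show ?thesis
    using coverable_add[OF coverable_two[OF assms(1)] coverable_mult[OF coverable_two[OF assms(1)], of j]]
    by (simp add: algebra_simps)
next
  case (2 j)
  then show ?thesis
    using coverable_add[OF coverable_three[of q] coverable_mult[OF coverable_two[OF assms(1)], of j]]
    by (simp add: algebra_simps)
qed

lemma coverable_copies_plus:
  assumes "q \<ge> 3" "odd q" "m \<ge> 2"
  shows "coverable (q + 1) (m + 1) (m * q + (q + 1))"
proof -
  from assms(2) have "even (q + 1)" by simp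
  then obtain h where h: "q + 1 = 2 * h" by (rule evenE)
  then have h2: "h \<ge> 2" using assms(1) by simp
  have q: "q \<ge> 2" using assms(1) by simp
  show ?thesis using assms(3)
  proof (cases rule: ge_2_cases)
    case (1 j)
    then have "3 + j * 2 = m + 1" "2 * q + (q + 1) + j * (2 * q) = m * q + (q + 1)"
      by (simp_all add: algebra_simps)
    then show ?thesis
      using coverable_add[OF coverable_two_plus[OF h h2] coverable_mult[OF coverable_two[OF q], of j]]
      by (simp only:)
  next
    case (2 j)
    then have "4 + j * 2 = m + 1" "3 * q + (q + 1) + j * (2 * q) = m * q + (q + 1)"
      by (simp_all add: algebra_simps)
    then show ?thesis
      using coverable_add[OF coverable_three_plus[OF h] coverable_mult[OF coverable_two[OF q], of j]]
      by (simp only:)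
  qed
qed

text \<open>Serves case (ii) with \<open>q + 1\<close> in place of \<open>q\<close>: there
  \<open>n\<close> is one short of \<open>r\<close> cliques on \<open>q + 1\<close>
  vertices.\<close>

lemma coverable_copies_minus:
  assumes "q \<ge> 3" "odd q" "r \<ge> 4" "even r"
  shows "coverable (q + 1) r (q * r - 1)"
proof -
  obtain h where h: "q = 2 * h + 1" using assms(2) by (rule oddE)
  have q: "q \<ge> 2" using assms(1) by simp
  define j where "j = (r - 4) div 2"
  have r: "r = 4 + j * 2" using assms(3,4) unfolding j_def by presburger
  have "4 * q - 1 + j * (2 * q) = q * r - 1" using assms(1) by (simp add: r algebra_simps)
  then show ?thesis
    using coverable_add[OF coverable_three_minus[OF h] coverable_mult[OF coverable_two[OF q], of j]]
    by (simp add: r)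
qed

text \<open>Two cliques on \<open>q + 1\<close> vertices are traded for one on \<open>q + 2\<close> vertices, which needs no cross
  edges, and one on \<open>q\<close> vertices.\<close>

lemma coverable_even:
  assumes "q \<ge> 2" "r \<ge> 4" "s < r" "even s"
  shows "coverable (q + 1) r (q * r + s)"
proof -
  obtain t where s: "s = 2 * t" using assms(4) by blast
  define m where "m = r - t"
  have r: "r = t + m" using assms(3) s by (simp add: m_def)
  have "m \<ge> 2" using assms s r by linarith
  from coverable_add[OF coverable_mult[OF coverable_clique[of q], of t] coverable_copies[OF assms(1) this]]
  show ?thesis by (simp add: s r algebra_simps mult_2_right)
qed

text \<open>After the trade of \<open>coverable_even\<close> a single clique on \<open>q + 1\<close>
  vertices is left over; it becomes the additional clique of
  \<open>coverable_copies_plus\<close>.\<close>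

lemma coverable_odd:
  assumes "q \<ge> 3" "odd q" "r \<ge> 4" "s < r" "odd s"
  shows "coverable (q + 1) r (q * r + s)"
proof -
  obtain t where s: "s = 2 * t + 1" using assms(5) by (rule oddE)
  define m where "m = r - t - 1"
  have r: "r = t + (m + 1)" using assms(4) s by (simp add: m_def)
  \<comment> \<open>\<open>2 * t + 2 \<le> r\<close> gives \<open>2 * m \<ge> r\<close>, so
    \<open>r \<ge> 4\<close> leaves two cliques on \<open>q\<close> vertices to host the additional
    one.\<close>
  have "m \<ge> 2" using assms s r by linarith
  from coverable_add[OF coverable_mult[OF coverable_clique[of q], of t]
      coverable_copies_plus[OF assms(1,2) this]]
  show ?thesis by (simp add: s r algebra_simps mult_2_right)
qed

section \<open>Lower bounds from coverings\<close>

text \<open>Among \<open>r + 1\<close> vertices two lie in the same clique of \<open>E\<close> by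
  the pigeonhole principle, and these are not adjacent in the complement \<open>G\<close>.\<close>

lemma coverable_regex_set:
  assumes "coverable D r n"
  shows "n - 1 - D \<in> regex_set n (complete_graph (r + 1))"
proof -
  obtain V E c where C: "clique_covered D r (V :: nat set) E c" and n: "card V = n"
    using assms by (auto simp: coverable_def)
  note C = C[unfolded clique_covered_def]
  define G where "G = (V, {{x, y} | x y. x \<in> V \<and> y \<in> V \<and> x \<noteq> y \<and> \<not> E x y})"
  have V: "verts G = V" by (simp add: G_def verts_def)
  have edge: "{x, y} \<in> edges G \<longleftrightarrow> x \<in> V \<and> y \<in> V \<and> x \<noteq> y \<and> \<not> E x y" for x y
    using C by (auto simp: G_def edges_def doubleton_eq_iff)
  have "simple_graph G" using C by (auto simp: simple_graph_def G_def verts_def edges_def)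
  moreover have "regular G (n - 1 - D)" unfolding regular_def degree_def V
  proof
    fix v assume v: "v \<in> V"
    have "{u \<in> V. {v, u} \<in> edges G} = V - {v} - {y\<in>V. E v y}" using v edge by auto
    moreover have "{y\<in>V. E v y} \<subseteq> V - {v}" using C v by auto
    ultimately show "card {u \<in> V. {v, u} \<in> edges G} = n - 1 - D"
      using C v n by (simp add: card_Diff_subset)
  qed
  moreover have "free_of G (complete_graph (r + 1))"
    unfolding free_of_def contains_copy_def
  proof (rule notI, elim exE conjE)
    fix f assume im: "f ` verts (complete_graph (r + 1)) \<subseteq> verts G"
      and ed: "\<forall>e\<in>edges (complete_graph (r + 1)). f ` e \<in> edges G"
    have vK: "verts (complete_graph (r + 1)) = {..<r + 1}" by (simp add: complete_graph_def verts_def)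
    have fV: "f i \<in> V" if "i < r + 1" for i using im that unfolding vK V by blast
    have "(c \<circ> f) ` {..<r + 1} \<subseteq> {..<r}" using fV C by auto
    then have "card ((c \<circ> f) ` {..<r + 1}) \<le> card {..<r}" by (rule card_mono[rotated]) simp
    then have "card ((c \<circ> f) ` {..<r + 1}) < card {..<r + 1}" by simp
    then have "\<not> inj_on (c \<circ> f) {..<r + 1}" by (rule pigeonhole)
    then obtain i j where ij: "i < r + 1" "j < r + 1" "i \<noteq> j" "c (f i) = c (f j)"
      by (auto simp: inj_on_def)
    have "{i, j} \<in> edges (complete_graph (r + 1))"
      using ij by (auto simp: complete_graph_def edges_def)
    with ed have "f ` {i, j} \<in> edges G" by blast
    then have "\<not> E (f i) (f j)" "f i \<noteq> f j" by (auto simp: edge)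
    then show False using C ij fV by blast
  qed
  ultimately show ?thesis unfolding regex_set_def using V n by blast
qed

section \<open>Regular graphs with small independence number\<close>

text \<open>Ordered adjacent pairs number \<open>card (verts G) * d\<close>, and swapping matches
  the increasing ones with the decreasing ones.\<close>

lemma regular_handshake:
  fixes G :: "nat ugraph"
  assumes "simple_graph G" "regular G d"
  shows "even (card (verts G) * d)"
proof -
  let ?V = "verts G" and ?E = "\<lambda>x y. {x, y} \<in> edges G"
  have fin: "finite ?V" using assms by (simp add: simple_graph_def)
  have irr: "\<not> ?E x x" for x using assms(1) by (fastforce simp: simple_graph_def)
  have sym: "?E x y \<Longrightarrow> ?E y x" for x y by (simp add: insert_commute)
  let ?P = "{p \<in> ?V \<times> ?V. fst p < snd p \<and> ?E (fst p) (snd p)}"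
  let ?Q = "{p \<in> ?V \<times> ?V. snd p < fst p \<and> ?E (fst p) (snd p)}"
  have "finite ?P" "finite ?Q" using fin by simp_all
  have eq: "Sigma ?V (\<lambda>x. {y\<in>?V. ?E x y}) = ?P \<union> ?Q"
  proof (rule set_eqI)
    fix p :: "nat \<times> nat"
    obtain x y where p: "p = (x, y)" by fastforce
    show "p \<in> Sigma ?V (\<lambda>x. {y\<in>?V. ?E x y}) \<longleftrightarrow> p \<in> ?P \<union> ?Q"
      using irr[of x] by (cases x y rule: linorder_cases) (auto simp: p)
  qed
  have "card (Sigma ?V (\<lambda>x. {y\<in>?V. ?E x y})) = card ?P + card ?Q"
    unfolding eq using \<open>finite ?P\<close> \<open>finite ?Q\<close> by (intro card_Un_disjoint) auto
  also have "card ?Q = card ?P"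
    by (rule bij_betw_same_card[of prod.swap], rule bij_betw_byWitness[of _ prod.swap])
      (auto intro: sym)
  finally have "card (Sigma ?V (\<lambda>x. {y\<in>?V. ?E x y})) = 2 * card ?P" by simp
  moreover have "card (Sigma ?V (\<lambda>x. {y\<in>?V. ?E x y})) = card ?V * d"
    using assms(2) fin by (simp add: regular_def degree_def)
  ultimately show ?thesis by simp
qed

text \<open>\<open>H\<close> as the upper bound sees it: the clique cover is weakened to its
  consequence, independence number at most \<open>r\<close>.\<close>

locale regular_relation =
  fixes V :: "'a set" and E :: "'a \<Rightarrow> 'a \<Rightarrow> bool" and D r :: nat
  assumes fin: "finite V"
    and sym: "E x y \<Longrightarrow> E y x"
    and irr: "\<not> E x x"
    and deg: "x \<in> V \<Longrightarrow> card {y\<in>V. E x y} = D"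
    and indep: "I \<subseteq> V \<Longrightarrow> (\<forall>x\<in>I. \<forall>y\<in>I. \<not> E x y) \<Longrightarrow> card I \<le> r"
begin

lemma sym_iff: "E x y \<longleftrightarrow> E y x"
  using sym by blast

definition nbh :: "'a \<Rightarrow> 'a set" where "nbh x = insert x {y\<in>V. E x y}"

lemma card_nbh: "x \<in> V \<Longrightarrow> card (nbh x) = D + 1"
  unfolding nbh_def using fin deg irr by simp

text \<open>\<open>indep\<close> bounds the sizes of independent sets, so a largest one exists; a
  vertex outside all its closed neighbourhoods could be added.\<close>

lemma maximal_independent:
  obtains I where "I \<subseteq> V" "\<forall>x\<in>I. \<forall>y\<in>I. \<not> E x y" "\<And>v. v \<in> V \<Longrightarrow> \<exists>i\<in>I. v \<in> nbh i"
proof -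
  let ?P = "\<lambda>I. I \<subseteq> V \<and> (\<forall>x\<in>I. \<forall>y\<in>I. \<not> E x y)"
  have "?P {}" by simp
  moreover have "\<forall>I. ?P I \<longrightarrow> card I < r + 1" using indep by (simp add: less_Suc_eq_le)
  ultimately obtain I where I: "?P I" "\<And>J. ?P J \<Longrightarrow> card J \<le> card I"
    using ex_has_greatest_nat[of ?P "{}" card "r + 1"] by blast
  show ?thesis
  proof (rule that[of I])
    fix v assume v: "v \<in> V"
    show "\<exists>i\<in>I. v \<in> nbh i"
    proof (rule ccontr)
      assume *: "\<not> (\<exists>i\<in>I. v \<in> nbh i)"
      then have "v \<notin> I" "\<And>i. i \<in> I \<Longrightarrow> \<not> E i v \<and> \<not> E v i"
        using v sym by (auto simp: nbh_def)
      then have "?P (insert v I)" using I(1) v irr by auto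
      then have "card (insert v I) \<le> card I" by (rule I(2))
      then show False using \<open>v \<notin> I\<close> I(1) fin finite_subset[of I V] by simp
    qed
  qed (use I(1) in auto)
qed

text \<open>Both sides count the pairs \<open>(v, i)\<close> with
  \<open>v \<in> nbh i\<close>.\<close>

lemma double_count:
  assumes "I \<subseteq> V"
  shows "(\<Sum>v\<in>V. card {i\<in>I. v \<in> nbh i}) = card I * (D + 1)"
proof -
  have finI: "finite I" using assms fin finite_subset by blast
  have "(\<Sum>v\<in>V. card {i\<in>I. v \<in> nbh i}) = (\<Sum>v\<in>V. \<Sum>i\<in>I. if v \<in> nbh i then 1 else 0)"
    using finI by (simp add: sum.If_cases Int_def)
  also have "\<dots> = (\<Sum>i\<in>I. \<Sum>v\<in>V. if v \<in> nbh i then 1 else 0)" by (rule sum.swap)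
  also have "\<dots> = (\<Sum>i\<in>I. card {v\<in>V. v \<in> nbh i})"
    using fin by (simp add: sum.If_cases Int_def)
  also have "\<dots> = (\<Sum>i\<in>I. D + 1)"
  proof (rule sum.cong)
    fix i assume "i \<in> I"
    then have "i \<in> V" using assms by auto
    then have "{v\<in>V. v \<in> nbh i} = nbh i" by (auto simp: nbh_def)
    then show "card {v\<in>V. v \<in> nbh i} = D + 1" using card_nbh[OF \<open>i \<in> V\<close>] by simp
  qed simp
  finally show ?thesis by simp
qed

lemma card_le: "card V \<le> r * (D + 1)"
proof -
  obtain I where I: "I \<subseteq> V" "\<forall>x\<in>I. \<forall>y\<in>I. \<not> E x y" "\<And>v. v \<in> V \<Longrightarrow> \<exists>i\<in>I. v \<in> nbh i"
    using maximal_independent by blast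
  have finI: "finite I" using I fin finite_subset by blast
  have "card V = (\<Sum>v\<in>V. 1)" by simp
  also have "\<dots> \<le> (\<Sum>v\<in>V. card {i\<in>I. v \<in> nbh i})"
  proof (rule sum_mono)
    fix v assume "v \<in> V"
    then have "{i\<in>I. v \<in> nbh i} \<noteq> {}" using I(3) by blast
    then show "1 \<le> card {i\<in>I. v \<in> nbh i}" using finI by (simp add: Suc_le_eq card_gt_0_iff)
  qed
  also have "\<dots> = card I * (D + 1)" by (rule double_count[OF I(1)])
  also have "\<dots> \<le> r * (D + 1)" using indep[OF I(1,2)] by (rule mult_le_mono1)
  finally show ?thesis .
qed

text \<open>With \<open>D = q\<close> and \<open>s = r - 1\<close> this excludes the degree
  \<open>turan_delta n r\<close>, which \<open>card_le\<close> still permits.\<close>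

lemma card_not_one_less:
  assumes D: "D \<ge> 3"
  shows "card V + 1 \<noteq> r * (D + 1)"
proof
  assume n: "card V + 1 = r * (D + 1)"
  obtain I where I: "I \<subseteq> V" "\<forall>x\<in>I. \<forall>y\<in>I. \<not> E x y" "\<And>v. v \<in> V \<Longrightarrow> \<exists>i\<in>I. v \<in> nbh i"
    using maximal_independent by blast
  have finI: "finite I" using I fin finite_subset by blast
  define cnt where "cnt v = card {i\<in>I. v \<in> nbh i}" for v
  have cnt1: "cnt v \<ge> 1" if "v \<in> V" for v
  proof -
    have "{i\<in>I. v \<in> nbh i} \<noteq> {}" using I(3) that by blast
    then show ?thesis using finI by (simp add: cnt_def Suc_le_eq card_gt_0_iff)
  qed
  have sum: "(\<Sum>v\<in>V. cnt v - 1) + card V = card I * (D + 1)"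
  proof -
    have "(\<Sum>v\<in>V. cnt v - 1) + card V = (\<Sum>v\<in>V. (cnt v - 1) + 1)" by (simp only: sum.distrib) simp
    also have "\<dots> = (\<Sum>v\<in>V. cnt v)" by (intro sum.cong refl le_add_diff_inverse2 cnt1)
    finally show ?thesis using double_count[OF I(1)] by (simp add: cnt_def)
  qed
  \<comment> \<open>With \<open>card I < r\<close> the neighbourhoods would have at most
    \<open>card V - D\<close> vertices in total.\<close>
  have cI: "card I = r"
  proof (rule antisym)
    show "card I \<le> r" using indep[OF I(1,2)] .
    show "r \<le> card I"
    proof (rule ccontr)
      assume "\<not> r \<le> card I"
      then have "(card I + 1) * (D + 1) \<le> r * (D + 1)" by (intro mult_le_mono1) simp
      then show False using sum n D by (simp add: algebra_simps)
    qed
  qed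
  \<comment> \<open>The total excess is one, so a single vertex \<open>w\<close> lies in two
    neighbourhoods; elsewhere the cover is a partition.\<close>
  then have "(\<Sum>v\<in>V. cnt v - 1) = 1" using sum n by simp
  then obtain w where w: "w \<in> V" "cnt w - 1 = 1" "\<And>v. v \<in> V \<Longrightarrow> v \<noteq> w \<Longrightarrow> cnt v - 1 = 0"
    using sum_eq_1_iff[OF fin, of "\<lambda>v. cnt v - 1"] by auto
  have "card {i\<in>I. w \<in> nbh i} = 2" using w(2) by (simp add: cnt_def)
  then obtain a b where ab: "{i\<in>I. w \<in> nbh i} = {a, b}" "a \<noteq> b" by (meson card_2_iff)
  then have aI: "a \<in> I" "b \<in> I" "w \<in> nbh a" "w \<in> nbh b" by auto
  have aV: "a \<in> V" "b \<in> V" using aI I by auto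
  have unique: "i = j" if "v \<in> V" "v \<noteq> w" "i \<in> I" "j \<in> I" "v \<in> nbh i" "v \<in> nbh j" for v i j
  proof -
    have "card {i\<in>I. v \<in> nbh i} = 1"
      using w(3)[OF that(1,2)] cnt1[OF that(1)] by (simp add: cnt_def)
    then obtain z where "{i\<in>I. v \<in> nbh i} = {z}" by (meson card_1_singletonE)
    moreover have "i \<in> {i\<in>I. v \<in> nbh i}" "j \<in> {i\<in>I. v \<in> nbh i}" using that by simp_all
    ultimately show ?thesis by simp
  qed
  have wI: "w \<notin> I"
  proof
    assume "w \<in> I"
    then have "w = a" "w = b" using aI I(2) by (auto simp: nbh_def)
    then show False using ab(2) by simp
  qed
  have Ewa: "E w a" "E w b" using aI wI sym by (auto simp: nbh_def)
  have wE: "i = a \<or> i = b" if "i \<in> I" "E w i" for i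
    using ab(1) that sym w(1) by (fastforce simp: nbh_def)
  then have w_other: "\<not> E w i \<and> \<not> E i w" if "i \<in> I" "i \<noteq> a" "i \<noteq> b" for i
    using that sym by blast
  \<comment> \<open>For \<open>i \<in> I\<close>, the part of \<open>nbh i\<close> that no other
    vertex of \<open>I\<close> covers.\<close>
  define priv where "priv i = nbh i - {w}" for i
  have privV: "priv i \<subseteq> V" if "i \<in> I" for i using that I by (auto simp: priv_def nbh_def)
  have other: "\<not> E x j \<and> \<not> E j x \<and> x \<noteq> j"
    if "i \<in> I" "x \<in> priv i" "j \<in> I" "j \<noteq> i" for i x j
  proof -
    have "x \<in> V" using privV that by blast
    then have "x \<notin> nbh j" using unique[of x i j] that by (auto simp: priv_def)
    then show ?thesis using \<open>x \<in> V\<close> sym by (auto simp: nbh_def)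
  qed
  have clique: "E x y" if i: "i \<in> I" and x: "x \<in> priv i" and y: "y \<in> priv i" and "x \<noteq> y" for i x y
  proof (rule ccontr)
    assume nE: "\<not> E x y"
    \<comment> \<open>Exchanging \<open>i\<close> for \<open>x\<close> and \<open>y\<close> would
      give \<open>r + 1\<close> independent vertices.\<close>
    let ?J = "insert x (insert y (I - {i}))"
    have "?J \<subseteq> V" using privV i x y I by auto
    moreover have "\<forall>u\<in>?J. \<forall>v\<in>?J. \<not> E u v"
      using nE sym_iff irr I(2) other[OF i x] other[OF i y] by auto
    ultimately have "card ?J \<le> r" by (rule indep)
    moreover have "x \<notin> insert y (I - {i})" "y \<notin> I - {i}"
      using other[OF i x] other[OF i y] \<open>x \<noteq> y\<close> by auto
    moreover have "card (I - {i}) = r - 1" "r \<ge> 1" using i cI finI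
      by (auto simp: Suc_le_eq card_gt_0_iff)
    ultimately show False using finI by simp
  qed
  have card_priv: "card (priv i) = D" if "i \<in> {a, b}" for i
    using that aI aV card_nbh fin by (auto simp: priv_def)
  have disj: "priv a \<inter> priv b = {}" 
  proof -
    have "x \<notin> priv b" if "x \<in> priv a" for x
      using other[OF aI(1) that aI(2)] ab(2) by (auto simp: priv_def nbh_def)
    then show ?thesis by blast
  qed
  have joined: "E x y" if x: "x \<in> priv a" "\<not> E w x" and y: "y \<in> priv b" "\<not> E w y" for x y
  proof (rule ccontr)
    assume nE: "\<not> E x y"
    \<comment> \<open>Exchanging \<open>a\<close> and \<open>b\<close> for \<open>w\<close>,
      \<open>x\<close> and \<open>y\<close> would again give \<open>r + 1\<close> independent
      vertices.\<close>
    let ?J = "insert w (insert x (insert y (I - {a, b})))"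
    have xy: "x \<noteq> y" "x \<noteq> w" "y \<noteq> w" using disj x y by (auto simp: priv_def)
    have "?J \<subseteq> V" using privV aI x y I w(1) by auto
    moreover have "\<forall>u\<in>?J. \<forall>v\<in>?J. \<not> E u v"
      using nE sym_iff irr I(2) other[OF aI(1) x(1)] other[OF aI(2) y(1)] x(2) y(2) w_other by auto
    ultimately have "card ?J \<le> r" by (rule indep)
    moreover have "w \<notin> insert x (insert y (I - {a, b}))" "x \<notin> insert y (I - {a, b})"
      "y \<notin> I - {a, b}"
      using xy wI other[OF aI(1) x(1)] other[OF aI(2) y(1)] by auto
    moreover have "card (I - {a, b}) + 2 = r"
    proof -
      have "card {a, b} \<le> card I" using aI finI by (intro card_mono) auto
      then show ?thesis using aI cI ab(2) finI by (simp add: card_Diff_subset)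
    qed
    ultimately show False using finI by simp
  qed
  \<comment> \<open>\<open>x\<close> has \<open>D - 1\<close> neighbours in its clique
    \<open>priv i\<close>, so at most one in \<open>B\<close>. Below, \<open>B\<close> is
    \<open>priv b\<close> and, with the roles exchanged, \<open>priv a\<close>.\<close>
  have few: "card {y \<in> B. \<not> E w y} \<le> 1"
    if i: "i \<in> I" and A: "card (priv i) = D" and B: "B \<subseteq> V" "priv i \<inter> B = {}"
      and x: "x \<in> priv i" and J: "\<And>y. y \<in> B \<Longrightarrow> \<not> E w y \<Longrightarrow> E x y" for i x B
  proof -
    have finP: "finite (priv i)" using privV[OF i] fin finite_subset by blast
    have finB: "finite {y \<in> B. \<not> E w y}" using B fin finite_subset[of B V] by auto
    have xV: "x \<in> V" using privV i x by blast
    have "(priv i - {x}) \<union> {y \<in> B. \<not> E w y} \<subseteq> {y\<in>V. E x y}"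
      using clique[OF i x] J privV[OF i] B by auto
    then have "card ((priv i - {x}) \<union> {y \<in> B. \<not> E w y}) \<le> card {y\<in>V. E x y}"
      by (rule card_mono[rotated]) (simp add: fin)
    then have "card ((priv i - {x}) \<union> {y \<in> B. \<not> E w y}) \<le> D" using deg[OF xV] by simp
    moreover have "card ((priv i - {x}) \<union> {y \<in> B. \<not> E w y}) = (D - 1) + card {y \<in> B. \<not> E w y}"
      using finP finB B x A by (subst card_Un_disjoint) auto
    ultimately show ?thesis using D by simp
  qed
  define N where "N i = {y \<in> priv i. E w y}" for i
  define M where "M i = {y \<in> priv i. \<not> E w y}" for i
  have finP: "finite (priv i)" if "i \<in> I" for i using privV[OF that] fin finite_subset by blast
  have NM: "card (N i) + card (M i) = D" if "i \<in> {a, b}" for i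
  proof -
    have "priv i = N i \<union> M i" "N i \<inter> M i = {}" by (auto simp: N_def M_def)
    then show ?thesis
      using card_priv[OF that] finP that aI card_Un_disjoint[of "N i" "M i"] 
      by (metis finite_Un insertE singletonD)
  qed
  have "N a \<union> N b \<subseteq> {y\<in>V. E w y}" using privV aI by (auto simp: N_def)
  then have "card (N a \<union> N b) \<le> card {y\<in>V. E w y}"
    by (rule card_mono[rotated]) (simp add: fin)
  then have "card (N a \<union> N b) \<le> D" using deg[OF w(1)] by simp
  moreover have "card (N a \<union> N b) = card (N a) + card (N b)"
    using finP aI disj by (intro card_Un_disjoint) (auto simp: N_def)
  ultimately have NN: "card (N a) + card (N b) \<le> D" by simp
  \<comment> \<open>Both \<open>N a\<close> and \<open>N b\<close> are nonempty, so by
    \<open>NN\<close> each has at most \<open>D - 1\<close> elements. Hence \<open>M a\<close> and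
    \<open>M b\<close> contain vertices to which \<open>few\<close> applies.\<close>
  have "a \<in> N a" "b \<in> N b" using Ewa wI aI by (auto simp: N_def priv_def nbh_def)
  then have "card (N a) \<ge> 1" "card (N b) \<ge> 1"
    using finP aI by (auto simp: Suc_le_eq card_gt_0_iff N_def)
  then have "card (M a) \<ge> 1" "card (M b) \<ge> 1" using NN NM[of a] NM[of b] by auto
  then obtain x y where xy: "x \<in> M a" "y \<in> M b"
    by (metis card.empty equals0I not_one_le_zero)
  then have x: "x \<in> priv a" "\<not> E w x" and y: "y \<in> priv b" "\<not> E w y" by (auto simp: M_def)
  have "card (M b) \<le> 1" unfolding M_def
    by (rule few[OF aI(1) card_priv privV[OF aI(2)] disj x(1) joined[OF x]]) simp_all
  moreover have "card (M a) \<le> 1" unfolding M_def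
    by (rule few[OF aI(2) card_priv privV[OF aI(1)] disj[unfolded Int_commute[of "priv a"]] y(1)
          sym[OF joined[OF _ _ y]]]) simp_all
  \<comment> \<open>The two cliques contain at least \<open>2 * D - 2\<close> neighbours of
    \<open>w\<close>, which exceeds the bound \<open>D\<close> of \<open>NN\<close> because
    \<open>D \<ge> 3\<close>.\<close>
  ultimately show False using NN NM[of a] NM[of b] D by simp
qed

end

section \<open>Upper bounds on the degree\<close>

text \<open>An independent set of \<open>r + 1\<close> vertices in the complement is a clique of
  \<open>G\<close>, hence a copy of the complete graph.\<close>

lemma regular_relation_complement:
  fixes G :: "nat ugraph"
  assumes G: "simple_graph G" "card (verts G) = n" "regular G d" "free_of G (complete_graph (r + 1))"
  shows "regular_relation (verts G)
    (\<lambda>x y. x \<in> verts G \<and> y \<in> verts G \<and> x \<noteq> y \<and> {x, y} \<notin> edges G) (n - 1 - d) r"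
proof
  show fin: "finite (verts G)" using G(1) by (simp add: simple_graph_def)
  have irr: "{x, x} \<notin> edges G" for x using G(1) by (fastforce simp: simple_graph_def)
  fix x assume x: "x \<in> verts G"
  have "{y \<in> verts G. x \<in> verts G \<and> y \<in> verts G \<and> x \<noteq> y \<and> {x, y} \<notin> edges G}
      = verts G - {x} - {y \<in> verts G. {x, y} \<in> edges G}" using x by auto
  moreover have "{y \<in> verts G. {x, y} \<in> edges G} \<subseteq> verts G - {x}" using irr by auto
  moreover have "card {y \<in> verts G. {x, y} \<in> edges G} = d"
    using G(3) x by (simp add: regular_def degree_def)
  ultimately show "card {y \<in> verts G. x \<in> verts G \<and> y \<in> verts G \<and> x \<noteq> y \<and> {x, y} \<notin> edges G} = n - 1 - d"
    using fin G(2) x by (simp add: card_Diff_subset)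
next
  fix I assume I: "I \<subseteq> verts G"
    "\<forall>x\<in>I. \<forall>y\<in>I. \<not> (x \<in> verts G \<and> y \<in> verts G \<and> x \<noteq> y \<and> {x, y} \<notin> edges G)"
  show "card I \<le> r"
  proof (rule ccontr)
    assume "\<not> card I \<le> r"
    then obtain J where J: "J \<subseteq> I" "card J = r + 1"
      by (metis not_less_eq_eq obtain_subset_with_card_n Suc_eq_plus1)
    then have "finite J" using card.infinite by fastforce
    then obtain f where f: "bij_betw f {0..<r + 1} J" using J(2) ex_bij_betw_nat_finite by metis
    then have f: "inj_on f {..<r + 1}" "f ` {..<r + 1} = J"
      by (auto simp: bij_betw_def lessThan_atLeast0)
    have "f ` e \<in> edges G" if "e \<subseteq> {..<r + 1}" "card e = 2" for e
    proof -
      obtain i j where ij: "e = {i, j}" "i \<noteq> j" using \<open>card e = 2\<close> by (meson card_2_iff)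
      then have "f i \<in> J" "f j \<in> J" "f i \<noteq> f j" using f that by (auto simp: inj_on_def)
      moreover from this have "f i \<in> verts G" "f j \<in> verts G" "f i \<in> I" "f j \<in> I"
        using I(1) J(1) by auto
      ultimately have "{f i, f j} \<in> edges G" using I(2) by blast
      then show ?thesis using ij by simp
    qed
    then have "contains_copy G (complete_graph (r + 1))"
      unfolding contains_copy_def complete_graph_def verts_def edges_def
      using f I(1) J(1) by (intro exI[of _ f]) (auto simp: verts_def)
    then show False using G(4) by (simp add: free_of_def)
  qed
qed (auto simp: insert_commute)

lemma regex_set_cases:
  assumes "d \<in> regex_set n (complete_graph (r + 1))" "n = q * r + s" "1 \<le> s" "s < r"
  shows "d \<le> n - q - 1" "even (n * d)" "q \<ge> 3 \<Longrightarrow> s = r - 1 \<Longrightarrow> d \<noteq> n - q - 1"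
proof -
  obtain G :: "nat ugraph" where G: "simple_graph G" "card (verts G) = n" "regular G d"
    "free_of G (complete_graph (r + 1))"
    using assms(1) by (auto simp: regex_set_def)
  show "even (n * d)" using regular_handshake[OF G(1,3)] G(2) by simp
  interpret regular_relation "verts G"
    "\<lambda>x y. x \<in> verts G \<and> y \<in> verts G \<and> x \<noteq> y \<and> {x, y} \<notin> edges G" "n - 1 - d" r
    using regular_relation_complement[OF G] .
  have le: "n \<le> r * (n - 1 - d + 1)" using card_le by (simp add: G(2))
  have "q \<le> n - 1 - d"
  proof (rule ccontr)
    assume "\<not> q \<le> n - 1 - d"
    then have "r * (n - 1 - d + 1) \<le> r * q" by (intro mult_le_mono2) simp
    then show False using le assms(2,3) by (simp add: mult.commute)
  qed
  \<comment> \<open>Subtraction is truncated: for \<open>q = 0\<close> the preceding bound says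
    nothing about \<open>d\<close>, so \<open>d \<le> n - 1\<close> is derived from
    simplicity.\<close>
  moreover have "q \<ge> 1 \<or> d \<le> n - 1"
  proof -
    obtain v where v: "v \<in> verts G" using G(2) assms(2,3) by fastforce
    have "\<not> {v, v} \<in> edges G" using G(1) by (fastforce simp: simple_graph_def)
    then have "{u \<in> verts G. {v, u} \<in> edges G} \<subseteq> verts G - {v}" by auto
    then have "card {u \<in> verts G. {v, u} \<in> edges G} \<le> card (verts G - {v})"
      by (rule card_mono[rotated]) (simp add: fin)
    then have "card {u \<in> verts G. {v, u} \<in> edges G} \<le> n - 1" using v fin G(2) by simp
    then show ?thesis using G(3) v by (simp add: regular_def degree_def)
  qed
  ultimately show "d \<le> n - q - 1" by linarith
  show "d \<noteq> n - q - 1" if "q \<ge> 3" "s = r - 1"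
  proof
    assume d: "d = n - q - 1"
    have "q \<le> q * r" using assms(3,4) by simp
    then have "q + 1 \<le> n" using assms(2,3) by linarith
    then have "n - 1 - d = q" using d by simp
    moreover have "n + 1 = r * (q + 1)" using assms(2,3,4) that by (simp add: algebra_simps)
    ultimately show False using card_not_one_less that(1) G(2) by simp
  qed
qed

section \<open>The three cases\<close>

lemma regex_eqI:
  assumes "coverable D r n" "n > 0"
    and "\<And>d. d \<in> regex_set n (complete_graph (r + 1)) \<Longrightarrow> d \<le> n - 1 - D"
  shows "regex n (complete_graph (r + 1)) = n - 1 - D"
  unfolding regex_def
  using regex_set_finite[OF assms(2)] assms(3) coverable_regex_set[OF assms(1)]
  by (rule Max_eqI)

theorem theorem1p2:
  fixes r :: nat
  assumes "r \<ge> 4"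
  shows "\<exists>q0 :: nat. \<forall>q s n :: nat. q \<ge> q0 \<longrightarrow> 1 \<le> s \<longrightarrow> s \<le> r - 1 \<longrightarrow> n = q * r + s \<longrightarrow>
    (odd q \<and> odd (r - s) \<longrightarrow>
       int (regex n (complete_graph (r + 1))) = int (turan_delta n r) - 1) \<and>
    (even q \<and> even r \<and> s = r - 1 \<longrightarrow>
       int (regex n (complete_graph (r + 1))) = int (turan_delta n r) - 2) \<and>
    (even q \<and> odd r \<and> s = r - 1 \<longrightarrow>
       int (regex n (complete_graph (r + 1))) = int (turan_delta n r) - 1)"
\<comment> \<open>The value 3 is what \<open>card_not_one_less\<close> with \<open>D = q\<close> and
  \<open>coverable_odd\<close> require.\<close>
proof (rule exI[of _ 3], intro allI impI, goal_cases)
  case (1 q s n)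
  then have q: "q \<ge> 3" and s: "1 \<le> s" "s < r" and n: "n = q * r + s" using assms by auto
  have "q * 4 \<le> q * r" using assms by (intro mult_le_mono2)
  then have big: "n \<ge> q + 4" using n s q by linarith
  have delta: "turan_delta n r = n - q - 1" using turan_delta_eq[OF s(2) n] big s by simp
  note cases = regex_set_cases[OF _ n s]
  show ?case
  proof (intro conjI impI)
    assume odd: "odd q \<and> odd (r - s)"
    then have oddn: "odd n" using n s by auto
    have cov: "coverable (q + 1) r n"
      using coverable_even[of q r s] coverable_odd[of q r s] q assms s odd n by (cases "even s") auto
    have "regex n (complete_graph (r + 1)) = n - 1 - (q + 1)"
    proof (rule regex_eqI[OF cov])
      fix d assume d: "d \<in> regex_set n (complete_graph (r + 1))"
      \<comment> \<open>\<open>n\<close> and \<open>q\<close> are odd, so \<open>n - q - 1\<close>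
        is odd, whereas the handshake lemma makes \<open>d\<close> even.\<close>
      have "even d" using cases(2)[OF d] oddn by simp
      then have "d + q + 1 \<noteq> n" using oddn odd by auto
      then have "d \<noteq> n - q - 1" using big by linarith
      then show "d \<le> n - 1 - (q + 1)" using cases(1)[OF d] by linarith
    qed (use big in simp)
    then show "int (regex n (complete_graph (r + 1))) = int (turan_delta n r) - 1"
      using delta big by simp
  next
    assume ev: "even q \<and> even r \<and> s = r - 1"
    then have oddn: "odd n" using n s by auto
    have "n = (q + 1) * r - 1" using ev n s by (simp add: algebra_simps)
    then have cov: "coverable (q + 2) r n"
      using coverable_copies_minus[of "q + 1" r] q assms ev by simp
    have "regex n (complete_graph (r + 1)) = n - 1 - (q + 2)"
    proof (rule regex_eqI[OF cov])
      fix d assume d: "d \<in> regex_set n (complete_graph (r + 1))"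
      \<comment> \<open>Parity excludes only \<open>n - q - 2\<close>; the even value
        \<open>n - q - 1\<close> is excluded by \<open>cases(3)\<close>.\<close>
      have "even d" using cases(2)[OF d] oddn by simp
      then have "d + q + 2 \<noteq> n" using oddn ev by auto
      then have "d \<noteq> n - q - 2" using big by linarith
      then show "d \<le> n - 1 - (q + 2)" using cases(1)[OF d] cases(3)[OF d q] ev by linarith
    qed (use big in simp)
    then show "int (regex n (complete_graph (r + 1))) = int (turan_delta n r) - 2"
      using delta big by simp
  next
    assume ev: "even q \<and> odd r \<and> s = r - 1"
    \<comment> \<open>Here \<open>s\<close> is even, so the trade leaves no clique on
      \<open>q + 1\<close> vertices. As \<open>n\<close> is even, only \<open>cases(3)\<close>
      excludes \<open>n - q - 1\<close>.\<close>
    then have cov: "coverable (q + 1) r n"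
      using coverable_even[of q r s] q assms s n by simp
    have "regex n (complete_graph (r + 1)) = n - 1 - (q + 1)"
    proof (rule regex_eqI[OF cov])
      fix d assume d: "d \<in> regex_set n (complete_graph (r + 1))"
      then show "d \<le> n - 1 - (q + 1)" using cases(1)[OF d] cases(3)[OF d q] ev by linarith
    qed (use big in simp)
    then show "int (regex n (complete_graph (r + 1))) = int (turan_delta n r) - 1"
      using delta big by simp
  qed
qed

end
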